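(* Let $D\subset\mathbb R^{n,1}$ be a domain of dependence and let $v$ be a future-directed timelike unit vector. For every fixed $x\in P_v$ the function $\epsilon\mapsto \iota_\epsilon(x)$, $\epsilon>0$, is increasing. Moreover the function $$\iota(x)=\lim_{\epsilon\to 0}\iota_\epsilon(x)=\inf_{\epsilon>0}\iota_\epsilon(x),\qquad x\in P_v,$$ is finite-valued at each point and locally bounded.
   Context: $\mathbb R^{n,1}$ is $\mathbb R^{n+1}$ with the Minkowski form $\langle x,x\rangle=-x_0^2+x_1^2+\dots+x_n^2$, time-oriented by $x_0$. A domain of dependence is an open convex domain $D\subset\mathbb R^{n,1}$ which is the intersection of the futures of a family of lightlike hyperplanes, such that the complement of $D$ contains at least two non-parallel lightlike hyperplanes. The cosmological time $\tau:D\to(0,\infty)$ is $\tau(p)=\sup\{\text{Lorentzian length of } c\}$, over causal curves $c$ in $D$ ending at $p$. Known facts: $\tau$ is finite and $C^{1,1}$; the level sets $H_\epsilon=\tau^{-1}(\epsilon)$ are spacelike hypersurfaces; for $p\in D$ there is a unique point $\mathbf r(p)\in\partial D\cap I^-(p)$ with $\tau(p)=|p-\mathbf r(p)|$, where $|w|=\sqrt{-\langle w,w\rangle}$ for timelike $w$, and $p-\mathbf r(p)$ is normal to the level set through $p$. $P_v$ is the spacelike hyperplane through $0$ orthogonal to $v$. For $\epsilon>0$, $H_\epsilon$ is the graph $\{x+u_\epsilon(x)v : x\in P_v\}$ of a convex function $u_\epsilon:P_v\to\mathbb R$. Let $\nu_\epsilon(q)$ be the future-directed unit normal of $H_\epsilon$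 at $q$. Then $$\iota_\epsilon(x)=-\epsilon\,\langle \nu_\epsilon(x+u_\epsilon(x)v),v\rangle,\qquad x\in P_v.$$ *)

theory Defs
  imports "HOL-Analysis.Analysis"
begin

text \<open>
  The first component of a point of \<open>real \<times> (real ^ 'n)\<close> is the time coordinate, and
  \<open>n = CARD('n)\<close>.  The topology is the Euclidean one.
\<close>

type_synonym 'n minkowski = "real \<times> (real ^ 'n)"

definition mink :: "'n::finite minkowski \<Rightarrow> 'n minkowski \<Rightarrow> real" where
  "mink x y = - (fst x * fst y) + snd x \<bullet> snd y"

definition future_timelike :: "'n::finite minkowski \<Rightarrow> bool" where
  "future_timelike w \<longleftrightarrow> mink w w < 0 \<and> fst w > 0"

definition future_causal :: "'n::finite minkowski \<Rightarrow> bool" where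
  "future_causal w \<longleftrightarrow> mink w w \<le> 0 \<and> fst w > 0"

definition lightlike_hyperplane :: "'n::finite minkowski set \<Rightarrow> bool" where
  "lightlike_hyperplane P \<longleftrightarrow>
     (\<exists>w c. w \<noteq> 0 \<and> mink w w = 0 \<and> P = {x. mink x w = c})"

definition chron_future :: "'n::finite minkowski set \<Rightarrow> 'n minkowski set" where
  "chron_future S = {q. \<exists>p\<in>S. future_timelike (q - p)}"

definition domain_of_dependence :: "'n::finite minkowski set \<Rightarrow> bool" where
  "domain_of_dependence D \<longleftrightarrow>
     D \<noteq> {} \<and> open D \<and> convex D \<and>
     (\<exists>F. (\<forall>P\<in>F. lightlike_hyperplane P) \<and> D = (\<Inter>P\<in>F. chron_future P)) \<and>
     (\<exists>P Q. lightlike_hyperplane P \<and> lightlike_hyperplane Q \<and>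
        P \<subseteq> - D \<and> Q \<subseteq> - D \<and> \<not> affine_parallel P Q)"

text \<open>
  Causal curves are piecewise \<open>C\<^sup>1\<close> and parametrised by the unit interval towards the future.
  The value of \<open>vector_derivative\<close> at the finitely many break points affects neither the
  definition nor the length.
\<close>

definition causal_curve :: "(real \<Rightarrow> 'n::finite minkowski) \<Rightarrow> bool" where
  "causal_curve c \<longleftrightarrow>
     c piecewise_C1_differentiable_on {0..1} \<and>
     (\<exists>S. finite S \<and> (\<forall>t\<in>{0..1} - S. future_causal (vector_derivative c (at t))))"

definition lorentz_length :: "(real \<Rightarrow> 'n::finite minkowski) \<Rightarrow> real" where
  "lorentz_length c =
     integral {0..1} (\<lambda>t. sqrt (- mink (vector_derivative c (at t)) (vector_derivative c (at t))))"

text \<open>The supremum is taken in \<open>ereal\<close>, where it always exists; for a domain of dependence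
  and \<open>p \<in> D\<close> it is finite and positive.\<close>

definition cosmological_time :: "'n::finite minkowski set \<Rightarrow> 'n minkowski \<Rightarrow> ereal" where
  "cosmological_time D p =
     (SUP c\<in>{c. causal_curve c \<and> c ` {0..1} \<subseteq> D \<and> c 1 = p}. ereal (lorentz_length c))"

definition level_set :: "'n::finite minkowski set \<Rightarrow> real \<Rightarrow> 'n minkowski set" where
  "level_set D \<epsilon> = {p \<in> D. cosmological_time D p = ereal \<epsilon>}"

definition orth_hyperplane :: "'n::finite minkowski \<Rightarrow> 'n minkowski set" where
  "orth_hyperplane v = {x. mink x v = 0}"

text \<open>For \<open>\<epsilon> > 0\<close> the level set of \<open>\<epsilon>\<close> is an entire graph over \<open>orth_hyperplane v\<close>,
  so the following description is unique.\<close>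

definition graph_fun :: "'n::finite minkowski set \<Rightarrow> 'n minkowski \<Rightarrow> real \<Rightarrow> 'n minkowski \<Rightarrow> real"
  where "graph_fun D v \<epsilon> x = (THE s. x + s *\<^sub>R v \<in> level_set D \<epsilon>)"

text \<open>Velocities of curves in \<open>S\<close> through \<open>q\<close>.  If \<open>S\<close> is a \<open>C\<^sup>1\<close> hypersurface this is the
  usual tangent space, hence for spacelike \<open>S\<close> there is exactly one future unit normal.\<close>

definition tangent_vectors :: "'n::finite minkowski set \<Rightarrow> 'n minkowski \<Rightarrow> 'n minkowski set" where
  "tangent_vectors S q =
     {w. \<exists>\<gamma> e. e > 0 \<and> \<gamma> ` {-e<..<e} \<subseteq> S \<and> \<gamma> 0 = q \<and> (\<gamma> has_vector_derivative w) (at 0)}"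

definition future_unit_normal :: "'n::finite minkowski set \<Rightarrow> 'n minkowski \<Rightarrow> 'n minkowski" where
  "future_unit_normal S q =
     (THE \<nu>. future_timelike \<nu> \<and> mink \<nu> \<nu> = -1 \<and> (\<forall>w\<in>tangent_vectors S q. mink \<nu> w = 0))"

definition iota_eps :: "'n::finite minkowski set \<Rightarrow> 'n minkowski \<Rightarrow> real \<Rightarrow> 'n minkowski \<Rightarrow> real"
  where "iota_eps D v \<epsilon> x =
     - \<epsilon> * mink (future_unit_normal (level_set D \<epsilon>) (x + graph_fun D v \<epsilon> x *\<^sub>R v)) v"

definition iota :: "'n::finite minkowski set \<Rightarrow> 'n minkowski \<Rightarrow> 'n minkowski \<Rightarrow> real" where
  "iota D v x = Lim (at_right 0) (\<lambda>\<epsilon>. iota_eps D v \<epsilon> x)"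

end

theory Submission
  imports Defs
begin

text \<open>
  The cosmological time \<open>\<tau> p\<close> is the maximum of \<open>|p - q|\<close> over the points \<open>q\<close> of the closure of
  the domain in the causal past of \<open>p\<close>, a compact set.  If the maximum is attained at \<open>r\<close>, then
  \<open>(p - r) / \<tau> p\<close> is the normal of the level set through \<open>p\<close>, so that \<open>\<iota>\<close> at \<open>p\<close> is
  \<open>- \<langle>p - r, v\<rangle>\<close>.  Along a line in direction \<open>v\<close> each \<open>|x + s v - q|\<^sup>2 - s\<^sup>2\<close> is affine in \<open>s\<close>, so
  \<open>\<tau>\<^sup>2 - s\<^sup>2\<close> is convex; as \<open>\<iota>\<close> is half the derivative of \<open>\<tau>\<^sup>2\<close>, it increases at least at unit
  speed in \<open>s\<close>.  Since \<open>0 \<le> \<iota> \<le> \<iota>\<^sub>\<epsilon>\<close>, local boundedness follows from that of \<open>p - r\<close>.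
\<close>

section \<open>Minkowski geometry\<close>

lemma mink_commute: "mink x y = mink y x"
  by (simp add: mink_def inner_commute mult.commute)

lemma mink_bilinear:
  "mink (a + b) c = mink a c + mink b c"
  "mink (a - b) c = mink a c - mink b c"
  "mink (- a) c = - mink a c"
  "mink (k *\<^sub>R a) c = k * mink a c"
  "mink a (b + c) = mink a b + mink a c"
  "mink a (b - c) = mink a b - mink a c"
  "mink a (- b) = - mink a b"
  "mink a (k *\<^sub>R b) = k * mink a b"
  "mink 0 a = 0" "mink a 0 = 0"
  by (simp_all add: mink_def inner_simps algebra_simps)

lemma mink_self: "mink w w = (norm (snd w))\<^sup>2 - (fst w)\<^sup>2"
  unfolding mink_def power2_norm_eq_inner by (simp add: power2_eq_square)

lemma continuous_on_mink [continuous_intros]: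
  "continuous_on S f \<Longrightarrow> continuous_on S g \<Longrightarrow> continuous_on S (\<lambda>x. mink (f x) (g x))"
  unfolding mink_def by (intro continuous_intros)

lemma tendsto_mink [tendsto_intros]:
  "(f \<longlongrightarrow> a) F \<Longrightarrow> (g \<longlongrightarrow> b) F \<Longrightarrow> ((\<lambda>x. mink (f x) (g x)) \<longlongrightarrow> mink a b) F"
  unfolding mink_def by (intro tendsto_intros)

text \<open>\<open>sqrt\<close> is odd, so a spacelike vector gets a negative value; facts about
  sign and square therefore assume \<open>causal_cone\<close>.\<close>

definition mink_len :: "'n::finite minkowski \<Rightarrow> real" where
  "mink_len w = sqrt (- mink w w)"

text \<open>The closed solid future cone, with 0 included, unlike \<open>future_causal\<close>; its
  closedness makes causal pasts closed.\<close>

definition causal_cone :: "'n::finite minkowski \<Rightarrow> bool" where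
  "causal_cone w \<longleftrightarrow> norm (snd w) \<le> fst w"

lemma future_timelike_iff: "future_timelike w \<longleftrightarrow> norm (snd w) < fst w"
proof
  assume "future_timelike w"
  then have "(norm (snd w))\<^sup>2 < (fst w)\<^sup>2" "fst w > 0"
    by (auto simp: future_timelike_def mink_self)
  then show "norm (snd w) < fst w" by (meson less_imp_le power_less_imp_less_base)
next
  assume *: "norm (snd w) < fst w"
  then have "(norm (snd w))\<^sup>2 < (fst w)\<^sup>2" by (intro power_strict_mono) auto
  moreover have "fst w > 0" using * norm_ge_zero[of "snd w"] by linarith
  ultimately show "future_timelike w"
    by (auto simp: future_timelike_def mink_self)
qed

lemma causal_cone_timelike: "future_timelike w \<Longrightarrow> causal_cone w"
  by (simp add: future_timelike_iff causal_cone_def)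

lemma causal_cone_causal: "future_causal w \<Longrightarrow> causal_cone w"
  unfolding future_causal_def causal_cone_def mink_self by (rule power2_le_imp_le) auto

lemma causal_cone_fst_nonneg: "causal_cone w \<Longrightarrow> 0 \<le> fst w"
  unfolding causal_cone_def using norm_ge_zero[of "snd w"] by linarith

lemma causal_cone_mink_nonpos: "causal_cone w \<Longrightarrow> mink w w \<le> 0"
  unfolding causal_cone_def mink_self by (simp add: power_mono)

lemma causal_coneI: "mink w w \<le> 0 \<Longrightarrow> 0 \<le> fst w \<Longrightarrow> causal_cone w"
  unfolding causal_cone_def mink_self by (rule power2_le_imp_le) auto

lemma timelike_cone_iff: "future_timelike w \<longleftrightarrow> causal_cone w \<and> mink w w < 0"
proof
  assume "future_timelike w" then show "causal_cone w \<and> mink w w < 0"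
    by (simp add: causal_cone_timelike) (simp add: future_timelike_def)
next
  assume *: "causal_cone w \<and> mink w w < 0"
  then have "fst w \<noteq> 0" by (auto simp: mink_self not_less)
  with * causal_cone_fst_nonneg[of w] show "future_timelike w"
    by (auto simp: future_timelike_def)
qed

lemma causal_cone_add: "causal_cone a \<Longrightarrow> causal_cone b \<Longrightarrow> causal_cone (a + b)"
  unfolding causal_cone_def using norm_triangle_ineq[of "snd a" "snd b"] by simp

lemma causal_cone_scaleR: "causal_cone a \<Longrightarrow> 0 \<le> k \<Longrightarrow> causal_cone (k *\<^sub>R a)"
  unfolding causal_cone_def by (simp add: mult_left_mono)

lemma closed_causal_cone: "closed {q. causal_cone (p - q)}"
  unfolding causal_cone_def by (intro closed_Collect_le continuous_intros)

lemma open_future_timelike: "open (Collect future_timelike)"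
proof -
  have "open {w :: 'a minkowski. norm (snd w) < fst w}"
    by (intro open_Collect_less continuous_intros)
  moreover have "Collect future_timelike = {w :: 'a minkowski. norm (snd w) < fst w}"
    by (auto simp: future_timelike_iff)
  ultimately show ?thesis by simp
qed

lemma mink_len_scaleR: "0 \<le> k \<Longrightarrow> mink_len (k *\<^sub>R w) = k * mink_len w"
proof -
  assume "0 \<le> k"
  have "- mink (k *\<^sub>R w) (k *\<^sub>R w) = k\<^sup>2 * (- mink w w)"
    by (simp add: mink_bilinear power2_eq_square)
  then have "mink_len (k *\<^sub>R w) = sqrt (k\<^sup>2) * sqrt (- mink w w)"
    unfolding mink_len_def by (simp only: real_sqrt_mult)
  with \<open>0 \<le> k\<close> show ?thesis by (simp add: mink_len_def)
qed

lemma mink_len_nonneg: "causal_cone w \<Longrightarrow> 0 \<le> mink_len w"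
  by (simp add: mink_len_def causal_cone_mink_nonpos)

lemma mink_len_sq: "causal_cone w \<Longrightarrow> (mink_len w)\<^sup>2 = - mink w w"
  by (simp add: mink_len_def causal_cone_mink_nonpos)

text \<open>Cauchy-Schwarz on the spatial parts. The explicit margin
  \<open>fst b - norm (snd b)\<close> yields the sign of causal products and, later, quantitative
  bounds on causal pasts.\<close>

lemma mink_cone_ge:
  assumes "causal_cone a"
  shows "fst a * (fst b - norm (snd b)) \<le> - mink a b"
proof -
  have "snd a \<bullet> snd b \<le> norm (snd a) * norm (snd b)" by (rule norm_cauchy_schwarz)
  also have "\<dots> \<le> fst a * norm (snd b)"
    using assms by (intro mult_right_mono) (auto simp: causal_cone_def)
  finally show ?thesis by (simp add: mink_def algebra_simps)
qed

lemma mink_causal_nonpos: "causal_cone a \<Longrightarrow> causal_cone b \<Longrightarrow> mink a b \<le> 0"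
  using mink_cone_ge[of a b] causal_cone_fst_nonneg[of a]
    mult_nonneg_nonneg[of "fst a" "fst b - norm (snd b)"]
  unfolding causal_cone_def by linarith

text \<open>After squaring, this rests on the identity
  \<open>(A^2 - a^2) * (B^2 - b^2) = (A*B - a*b)^2 - (A*b - B*a)^2\<close> for time components
  \<open>A\<close>, \<open>B\<close> and spatial norms \<open>a\<close>, \<open>b\<close>.\<close>

lemma reverse_cauchy_schwarz:
  assumes a: "causal_cone a" and b: "causal_cone b"
  shows "mink_len a * mink_len b \<le> - mink a b"
proof (rule power2_le_imp_le)
  let ?a = "norm (snd a)" and ?b = "norm (snd b)"
  have le: "fst a * fst b - ?a * ?b \<le> - mink a b"
    using norm_cauchy_schwarz[of "snd a" "snd b"] by (simp add: mink_def)
  have nn: "0 \<le> fst a * fst b - ?a * ?b"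
    using a b by (simp add: causal_cone_def mult_mono')
  have "(mink_len a * mink_len b)\<^sup>2 = ((fst a)\<^sup>2 - ?a\<^sup>2) * ((fst b)\<^sup>2 - ?b\<^sup>2)"
    using a b by (simp add: power_mult_distrib mink_len_sq mink_self)
  also have "\<dots> = (fst a * fst b - ?a * ?b)\<^sup>2 - (fst a * ?b - fst b * ?a)\<^sup>2"
    by algebra
  also have "\<dots> \<le> (fst a * fst b - ?a * ?b)\<^sup>2" by simp
  also have "\<dots> \<le> (- mink a b)\<^sup>2" using le nn by (intro power_mono)
  finally show "(mink_len a * mink_len b)\<^sup>2 \<le> (- mink a b)\<^sup>2" .
  show "0 \<le> - mink a b" using mink_causal_nonpos[OF a b] by simp
qed

lemma reverse_triangle:
  assumes a: "causal_cone a" and b: "causal_cone b"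
  shows "mink_len a + mink_len b \<le> mink_len (a + b)"
proof (rule power2_le_imp_le)
  have "(mink_len a + mink_len b)\<^sup>2
      = (mink_len a)\<^sup>2 + (mink_len b)\<^sup>2 + 2 * (mink_len a * mink_len b)"
    by algebra
  also have "\<dots> \<le> - mink a a - mink b b + 2 * (- mink a b)"
    using reverse_cauchy_schwarz[OF a b] a b by (simp add: mink_len_sq)
  also have "\<dots> = (mink_len (a + b))\<^sup>2"
    using a b mink_commute[of a b] by (simp add: mink_len_sq causal_cone_add mink_bilinear)
  finally show "(mink_len a + mink_len b)\<^sup>2 \<le> (mink_len (a + b))\<^sup>2" .
  show "0 \<le> mink_len (a + b)" using a b by (simp add: mink_len_nonneg causal_cone_add)
qed

section \<open>Strict signs of timelike products and uniqueness of unit normals\<close>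

lemma timelike_mink_neg:
  assumes "future_timelike a" "causal_cone b" "b \<noteq> 0"
  shows "mink b a < 0"
proof -
  have "0 < fst b"
  proof (rule ccontr)
    assume "\<not> 0 < fst b"
    with assms(2) have "fst b = 0" "snd b = 0"
      using causal_cone_fst_nonneg[of b] by (auto simp: causal_cone_def)
    with assms(3) show False by (simp add: prod_eq_iff)
  qed
  moreover have "0 < fst a - norm (snd a)" using assms(1) by (simp add: future_timelike_iff)
  ultimately have "0 < fst b * (fst a - norm (snd a))" by simp
  also have "\<dots> \<le> - mink b a"
    using mink_cone_ge[of b a] assms by (simp add: causal_cone_timelike)
  finally show ?thesis by simp
qed

text \<open>A vector that is not spacelike lies in the cone or in its negative, and there its
  product with a timelike vector has a strict sign unless it is 0.\<close>

lemma orthogonal_timelike_causal_zero: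
  assumes "future_timelike n" "mink w n = 0" "mink w w \<le> 0"
  shows "w = 0"
proof (rule ccontr)
  assume "w \<noteq> 0"
  have "causal_cone w \<or> causal_cone (- w)"
    using assms(3) causal_coneI[of w] causal_coneI[of "- w"] by (force simp: mink_bilinear)
  then show False
    using timelike_mink_neg[OF assms(1), of w] timelike_mink_neg[OF assms(1), of "- w"] assms(2)
      \<open>w \<noteq> 0\<close> by (auto simp: mink_bilinear)
qed

text \<open>\<open>w\<close> is the part of \<open>m\<close> orthogonal to \<open>n\<close>. By
  \<open>orth\<close> it is orthogonal to \<open>m\<close> too, hence to itself, and so vanishes;
  the common time orientation selects \<open>k = -1\<close>.\<close>

lemma unit_normal_unique:
  assumes n: "future_timelike n" "mink n n = -1"
    and m: "future_timelike m" "mink m m = -1"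
    and orth: "\<And>w. mink n w = 0 \<Longrightarrow> mink m w = 0"
  shows "m = n"
proof -
  define k where "k = mink m n"
  define w where "w = m + k *\<^sub>R n"
  have nw: "mink n w = 0" using n mink_commute[of n m] by (simp add: w_def k_def mink_bilinear)
  then have mw: "mink m w = 0" by (rule orth)
  then have "k\<^sup>2 = 1" using m by (simp add: w_def k_def mink_bilinear power2_eq_square)
  moreover have "k < 0" unfolding k_def using n m
    by (intro timelike_mink_neg) (auto simp: causal_cone_timelike future_timelike_def)
  ultimately have "k = -1" by (auto simp: power2_eq_1_iff)
  have "mink w w = 0" using nw mw by (simp add: w_def mink_bilinear(1,4))
  moreover have "mink w n = 0" using nw mink_commute by metis
  ultimately have "w = 0" using orthogonal_timelike_causal_zero[OF n(1)] by simp
  then show ?thesis using \<open>k = -1\<close> by (simp add: w_def)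
qed

abbreviation time_axis :: "'n::finite minkowski" where "time_axis \<equiv> (1, 0)"

lemma time_axis_simps [simp]:
  "mink (t, 0) w = - (t * fst w)" "mink w (t, 0) = - (t * fst w)" "future_timelike time_axis"
  by (simp_all add: mink_def future_timelike_def)

section \<open>Causal curves\<close>

text \<open>Pairing the integrated velocity with a fixed \<open>u\<close> carries pointwise
  inequalities over to the endpoints: duality of the cone gives the first claim, reverse
  Cauchy-Schwarz the second. In effect, straight segments maximise length.\<close>

lemma causal_curve_length_le:
  assumes "causal_curve c"
  shows "causal_cone (c 1 - c 0)" and "lorentz_length c \<le> mink_len (c 1 - c 0)"
proof -
  define d where "d = (\<lambda>t. vector_derivative c (at t))"
  define w where "w = c 1 - c 0"
  from assms obtain S1 where S1: "finite S1" "c C1_differentiable_on ({0..1} - S1)"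
      "continuous_on {0..1} c"
    unfolding causal_curve_def piecewise_C1_differentiable_on_def by auto
  from assms obtain S2 where S2: "finite S2" "\<And>t. t \<in> {0..1} - S2 \<Longrightarrow> future_causal (d t)"
    unfolding causal_curve_def d_def by auto
  define S where "S = S1 \<union> S2"
  have fin: "finite S" using S1 S2 by (simp add: S_def)
  have fc: "causal_cone (d t)" if "t \<in> {0..1} - S" for t
    using S2(2)[of t] that by (simp add: S_def causal_cone_causal)
  have "(c has_vector_derivative d t) (at t)" if "t \<in> {0..1} - S" for t
    using S1(2) that unfolding C1_differentiable_on_eq d_def S_def
    by (simp add: vector_derivative_works)
  then have int: "(d has_integral w) {0..1}"
    unfolding w_def using fin S1(3)
    by (intro fundamental_theorem_of_calculus_strong[where S = S]) auto
  have lin: "((\<lambda>t. - mink (d t) u) has_integral - mink w u) {0..1}" for u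
  proof -
    have "linear (\<lambda>x. - mink x u)" by (rule linearI) (simp_all add: mink_bilinear)
    then have "bounded_linear (\<lambda>x. - mink x u)" by (simp add: linear_conv_bounded_linear)
    from has_integral_linear[OF int this] show ?thesis by (simp add: o_def)
  qed
  have nonneg: "0 \<le> - mink w u" if u: "causal_cone u" for u
  proof (rule has_integral_nonneg)
    \<comment> \<open>\<open>d\<close> is uncontrolled on the finite set \<open>S\<close>, so the
      integrand is set to 0 there to make the sign hold everywhere.\<close>
    show "((\<lambda>t. if t \<in> S then 0 else - mink (d t) u) has_integral - mink w u) {0..1}"
      by (rule has_integral_spike_finite[OF fin _ lin[of u]]) auto
  qed (use fc mink_causal_nonpos[OF _ u] in auto)
  \<comment> \<open>Testing against \<open>(1, sgn (snd w))\<close>, whose spatial part points along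
    \<open>w\<close>, turns nonnegativity of the pairing into the cone inequality for
    \<open>w\<close>.\<close>
  have "snd w \<bullet> sgn (snd w) = norm (snd w)"
    by (cases "snd w = 0") (auto simp: sgn_div_norm dot_square_norm power2_eq_square)
  moreover have "causal_cone (1, sgn (snd w))" by (simp add: causal_cone_def norm_sgn)
  ultimately show J: "causal_cone (c 1 - c 0)"
    using nonneg[of "(1, sgn (snd w))"] by (simp add: causal_cone_def mink_def flip: w_def)
  have J': "causal_cone w" using J by (simp add: w_def)
  define f where "f = (\<lambda>t. mink_len (d t))"
  have L: "lorentz_length c = integral {0..1} f"
    by (simp add: lorentz_length_def f_def mink_len_def d_def)
  show "lorentz_length c \<le> mink_len (c 1 - c 0)"
  proof (cases "f integrable_on {0..1}")
    \<comment> \<open>A non-integrable speed has integral 0 by convention, so the bound is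
      trivial.\<close>
    case False
    then show ?thesis using J by (simp add: L not_integrable_integral mink_len_nonneg)
  next
    case True
    \<comment> \<open>Perturbing \<open>w\<close> into the timelike cone also covers the case where \<open>w\<close> is null.\<close>
    have le: "lorentz_length c \<le> mink_len (w + \<delta> *\<^sub>R time_axis)" if "\<delta> > 0" for \<delta>
    proof -
      define u where "u = w + \<delta> *\<^sub>R time_axis"
      have u: "future_timelike u" using J' that by (simp add: u_def future_timelike_iff causal_cone_def)
      then have Ju: "causal_cone u" by (rule causal_cone_timelike)
      have pos: "mink_len u > 0" using u by (simp add: mink_len_def future_timelike_def)
      have 1: "((\<lambda>t. if t \<in> S then 0 else f t * mink_len u)
          has_integral (lorentz_length c * mink_len u)) {0..1}"
        by (rule has_integral_spike_finite[OF fin _ has_integral_mult_left[OF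
              integrable_integral[OF True, folded L]]]) auto
      have 2: "((\<lambda>t. if t \<in> S then 0 else - mink (d t) u) has_integral - mink w u) {0..1}"
        by (rule has_integral_spike_finite[OF fin _ lin[of u]]) auto
      have "lorentz_length c * mink_len u \<le> - mink w u"
        using fc reverse_cauchy_schwarz[OF _ Ju]
        by (intro has_integral_le[OF 1 2]) (auto simp: f_def)
      also have "\<dots> \<le> - mink u u"
      proof -
        have "mink (w + \<delta> *\<^sub>R time_axis) u = mink w u - \<delta> * fst u"
          by (simp add: mink_bilinear)
        moreover have "0 \<le> \<delta> * fst u"
          using \<open>\<delta> > 0\<close> causal_cone_fst_nonneg[OF Ju] by simp
        ultimately show ?thesis unfolding u_def[symmetric] by linarith
      qed
      also have "\<dots> = mink_len u * mink_len u"
        using mink_len_sq[OF Ju] by (simp add: power2_eq_square)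
      finally show ?thesis using pos by (simp add: u_def)
    qed
    have "((\<lambda>\<delta>. mink_len (w + \<delta> *\<^sub>R time_axis)) \<longlongrightarrow> mink_len (w + 0 *\<^sub>R time_axis)) (at_right 0)"
      unfolding mink_len_def by (intro tendsto_intros)
    moreover have "\<forall>\<^sub>F \<delta> in at_right 0. lorentz_length c \<le> mink_len (w + \<delta> *\<^sub>R time_axis)"
      using le by (simp add: eventually_at_filter)
    ultimately have "lorentz_length c \<le> mink_len (w + 0 *\<^sub>R time_axis)"
      by (rule tendsto_lowerbound) simp
    then show ?thesis by (simp add: w_def flip: zero_prod_def)
  qed
qed

lemma segment_causal_curve:
  assumes "future_causal w"
    and c_def: "c = (\<lambda>t. a + t *\<^sub>R w)"
  shows "causal_curve c" and "lorentz_length c = mink_len w"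
proof -
  have d: "(c has_vector_derivative w) (at t)" for t
    unfolding c_def by (rule derivative_eq_intros refl | simp)+
  then have vd: "vector_derivative c (at t) = w" for t by (rule vector_derivative_at)
  have "c C1_differentiable_on {0..1}"
    unfolding C1_differentiable_on_def
    by (intro exI[of _ "\<lambda>_. w"] conjI ballI d continuous_on_const)
  then show "causal_curve c" unfolding causal_curve_def vd
    using assms(1) C1_differentiable_imp_piecewise by blast
  show "lorentz_length c = mink_len w"
    by (simp add: lorentz_length_def vd mink_len_def)
qed


section \<open>The cosmological time and the retraction onto the boundary\<close>

text \<open>With the normal oriented to the future, every future timelike step strictly lowers
  \<open>mink x w\<close>, and each point of the half-space descends along the time axis to the
  hyperplane.\<close>

lemma lightlike_hyperplaneE:
  assumes "lightlike_hyperplane P"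
  obtains w c where "0 < fst w" "norm (snd w) = fst w" "causal_cone w"
    "P = {x. mink x w = c}" "chron_future P = {q. mink q w < c}"
proof -
  from assms obtain w0 c0 where w0: "w0 \<noteq> 0" "mink w0 w0 = 0" "P = {x. mink x w0 = c0}"
    unfolding lightlike_hyperplane_def by blast
  define \<sigma> where "\<sigma> = (if fst w0 > 0 then 1 else - 1 :: real)"
  define w c where "w = \<sigma> *\<^sub>R w0" and "c = \<sigma> * c0"
  have \<sigma>: "\<sigma> \<noteq> 0" by (simp add: \<sigma>_def)
  have eq: "norm (snd w0) = \<bar>fst w0\<bar>"
    using w0(2) by (simp add: mink_self) (metis abs_norm_cancel power2_eq_iff_nonneg abs_ge_zero power2_abs)
  then have "fst w0 \<noteq> 0" using w0(1) by (auto simp: prod_eq_iff)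
  then have w: "0 < fst w" "norm (snd w) = fst w" using eq by (auto simp: w_def \<sigma>_def)
  then have Jw: "causal_cone w" and "w \<noteq> 0" by (auto simp: causal_cone_def)
  have P: "P = {x. mink x w = c}" using \<sigma> by (auto simp: w0(3) w_def c_def mink_bilinear)
  have "chron_future P = {q. mink q w < c}"
  proof (intro set_eqI iffI)
    fix q assume "q \<in> chron_future P"
    then obtain p where "p \<in> P" "future_timelike (q - p)" by (auto simp: chron_future_def)
    then show "q \<in> {q. mink q w < c}"
      using timelike_mink_neg[of "q - p" w] Jw \<open>w \<noteq> 0\<close>
      by (auto simp: P mink_bilinear mink_commute[of w])
  next
    fix q assume "q \<in> {q. mink q w < c}"
    then have t: "(c - mink q w) / fst w > 0" using w by simp
    have "q - ((c - mink q w) / fst w) *\<^sub>R time_axis \<in> P"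
      using w by (simp add: P mink_bilinear)
    then show "q \<in> chron_future P" unfolding chron_future_def
      using t by (auto intro!: bexI[of _ "q - ((c - mink q w) / fst w) *\<^sub>R time_axis"]
          simp: future_timelike_iff)
  qed
  with w Jw P show ?thesis by (rule that)
qed

section \<open>Upward closure of the domain and compactness of causal pasts\<close>

locale dependence_domain =
  fixes D :: "'n::finite minkowski set"
  assumes dod: "domain_of_dependence D"
begin

lemma nonempty: "D \<noteq> {}" and open_D: "open D" and convex_D: "convex D"
  using dod by (auto simp: domain_of_dependence_def)

lemma hyperplane_separates:
  assumes "p \<notin> D"
  obtains w c where "0 < fst w" "norm (snd w) = fst w" "causal_cone w"
    "\<And>q. q \<in> D \<Longrightarrow> mink q w < c" "c \<le> mink p w"
proof -
  obtain F where F: "\<And>P. P \<in> F \<Longrightarrow> lightlike_hyperplane P" "D = (\<Inter>P\<in>F. chron_future P)"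
    using dod by (auto simp: domain_of_dependence_def)
  with assms obtain P where P: "P \<in> F" "p \<notin> chron_future P" by auto
  obtain w c where "0 < fst w" "norm (snd w) = fst w" "causal_cone w"
    "chron_future P = {q. mink q w < c}"
    using lightlike_hyperplaneE[OF F(1)[OF P(1)]] by metis
  with P F that[of w c] show ?thesis by auto
qed

text \<open>Causal vectors pair nonpositively with future null normals, so each half-space cutting
  out \<open>D\<close> is preserved.\<close>

lemma add_causal: "q \<in> D \<Longrightarrow> causal_cone y \<Longrightarrow> q + y \<in> D"
proof (rule ccontr)
  assume q: "q \<in> D" and y: "causal_cone y" and "q + y \<notin> D"
  then obtain w c where "causal_cone w" "\<And>q. q \<in> D \<Longrightarrow> mink q w < c" "c \<le> mink (q + y) w"
    using hyperplane_separates by metis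
  moreover have "mink y w \<le> 0" using y calculation by (simp add: mink_causal_nonpos)
  ultimately show False using q unfolding mink_bilinear by (metis add_le_cancel_left add.right_neutral leD order_trans)
qed

lemma closure_halfspace:
  assumes "\<And>q. q \<in> D \<Longrightarrow> mink q w \<le> c" "q \<in> closure D"
  shows "mink q w \<le> c"
proof -
  have "closed {q. mink q w \<le> c}" by (intro closed_Collect_le continuous_intros)
  then have "closure D \<subseteq> {q. mink q w \<le> c}" using assms(1) by (intro closure_minimal) auto
  then show ?thesis using assms(2) by auto
qed

text \<open>The two hyperplanes in the complement may lie outside the family that defines
  \<open>D\<close>. A point of \<open>D\<close> below such a hyperplane could be moved up the time
  axis, staying in \<open>D\<close>, until it hit the hyperplane.\<close>

lemma disjoint_hyperplane_halfspace:
  assumes "0 < fst w" "{x. mink x w = c} \<subseteq> - D" "q \<in> D"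
  shows "mink q w \<le> c"
proof (rule ccontr)
  assume *: "\<not> mink q w \<le> c"
  define t where "t = (mink q w - c) / fst w"
  have "t > 0" using * assms(1) by (simp add: t_def)
  then have "q + t *\<^sub>R time_axis \<in> D"
    using assms(3) by (intro add_causal causal_cone_scaleR causal_cone_timelike) auto
  moreover have "mink (q + t *\<^sub>R time_axis) w = c"
    using assms(1) by (simp add: mink_bilinear t_def)
  ultimately show False using assms(2) by auto
qed

text \<open>Two non-parallel null normals have a timelike sum; this bounds causal pasts inside the domain.\<close>

lemma past_bounded:
  obtains C w where "future_timelike w"
    "\<And>p q. q \<in> closure D \<Longrightarrow> causal_cone (p - q) \<Longrightarrow> norm (p - q) \<le> C - mink p w"
proof -
  obtain P Q where PQ: "lightlike_hyperplane P" "lightlike_hyperplane Q" "P \<subseteq> - D" "Q \<subseteq> - D"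
      "\<not> affine_parallel P Q"
    using dod by (auto simp: domain_of_dependence_def)
  obtain w1 c1 where w1: "0 < fst w1" "norm (snd w1) = fst w1" "causal_cone w1"
      "P = {x. mink x w1 = c1}"
    using lightlike_hyperplaneE[OF PQ(1)] by metis
  obtain w2 c2 where w2: "0 < fst w2" "norm (snd w2) = fst w2" "causal_cone w2"
      "Q = {x. mink x w2 = c2}"
    using lightlike_hyperplaneE[OF PQ(2)] by metis
  \<comment> \<open>Equality in Cauchy-Schwarz makes orthogonal null normals proportional;
    translation by \<open>a\<close> along the time axis then carries \<open>P\<close> to
    \<open>Q\<close>, contradicting non-parallelism.\<close>
  have "mink w1 w2 \<noteq> 0"
  proof
    assume "mink w1 w2 = 0"
    then have "snd w1 \<bullet> snd w2 = norm (snd w1) * norm (snd w2)"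
      using w1 w2 by (simp add: mink_def)
    then have "norm (snd w1) *\<^sub>R snd w2 = norm (snd w2) *\<^sub>R snd w1"
      by (simp only: norm_cauchy_schwarz_eq)
    then have *: "fst w1 *\<^sub>R snd w2 = fst w2 *\<^sub>R snd w1"
      by (simp only: w1(2) w2(2))
    define k where "k = fst w2 / fst w1"
    have k: "k > 0" using w1 w2 by (simp add: k_def)
    have "snd w2 = (1 / fst w1) *\<^sub>R (fst w1 *\<^sub>R snd w2)" using w1(1) by simp
    then have w2k: "w2 = k *\<^sub>R w1" unfolding * using w1(1) by (simp add: k_def prod_eq_iff)
    define a where "a = ((c1 - c2 / k) / fst w1) *\<^sub>R (time_axis :: 'n minkowski)"
    have ma: "mink a w1 = c2 / k - c1" using w1(1) by (simp add: a_def mink_bilinear)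
    have "Q = (\<lambda>x. a + x) ` P"
    proof (intro set_eqI iffI)
      fix x assume "x \<in> Q"
      then have "mink x w1 = c2 / k" using k by (simp add: w2(4) w2k mink_bilinear field_simps)
      then have "x - a \<in> P" by (simp add: w1(4) mink_bilinear ma)
      then show "x \<in> (\<lambda>x. a + x) ` P" by (intro image_eqI[of _ _ "x - a"]) auto
    next
      fix x assume "x \<in> (\<lambda>x. a + x) ` P"
      then show "x \<in> Q" using k ma by (auto simp: w1 w2(4) w2k mink_bilinear field_simps)
    qed
    then show False using PQ(5) unfolding affine_parallel_def by blast
  qed
  then have neg: "mink w1 w2 < 0" using mink_causal_nonpos[OF w1(3) w2(3)] by simp
  define w where "w = w1 + w2"
  have Jw: "causal_cone w" using w1 w2 by (simp add: w_def causal_cone_add)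
  have "mink w1 w1 = 0" "mink w2 w2 = 0" using w1 w2 by (simp_all add: mink_self)
  then have "mink w w < 0" using neg mink_commute[of w1 w2] by (simp add: w_def mink_bilinear)
  then have "future_timelike w" using Jw timelike_cone_iff by blast
  \<comment> \<open>The Euclidean norm of a causal vector is at most twice its time component, hence
    the 2; dividing by the margin of \<open>w\<close> absorbs the constant into the normal.\<close>
  define k where "k = 2 / (fst w - norm (snd w))"
  have gap: "0 < fst w - norm (snd w)" using \<open>future_timelike w\<close> by (simp add: future_timelike_iff)
  then have k: "0 < k" by (simp add: k_def)
  have "norm (p - q) \<le> k * (c1 + c2) - mink p (k *\<^sub>R w)"
    if "q \<in> closure D" "causal_cone (p - q)" for p q
  proof -
    have "mink q w1 \<le> c1" "mink q w2 \<le> c2"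
      using closure_halfspace[OF disjoint_hyperplane_halfspace] that PQ w1 w2 by blast+
    then have "fst (p - q) * (fst w - norm (snd w)) \<le> (c1 + c2) - mink p w"
      using mink_cone_ge[OF that(2), of w] by (simp add: w_def mink_bilinear)
    then have "k * (fst (p - q) * (fst w - norm (snd w))) \<le> k * ((c1 + c2) - mink p w)"
      using k by (intro mult_left_mono) auto
    moreover have "k * (fst (p - q) * (fst w - norm (snd w))) = 2 * fst (p - q)"
      using gap by (simp add: k_def)
    ultimately have "2 * fst (p - q) \<le> k * (c1 + c2) - mink p (k *\<^sub>R w)"
      by (simp only: mink_bilinear right_diff_distrib)
    moreover have "norm (p - q) \<le> norm (fst (p - q)) + norm (snd (p - q))"
      by (metis norm_Pair_le prod.collapse)
    moreover have "norm (fst (p - q)) = fst (p - q)" "norm (snd (p - q)) \<le> fst (p - q)"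
      using that(2) causal_cone_fst_nonneg[OF that(2)] by (auto simp: causal_cone_def)
    ultimately show ?thesis by linarith
  qed
  moreover have "future_timelike (k *\<^sub>R w)"
    using \<open>future_timelike w\<close> k by (simp add: future_timelike_iff)
  ultimately show ?thesis using that by blast
qed

lemma compact_past: "compact {q \<in> closure D. causal_cone (p - q)}"
proof -
  obtain C w where C:
    "\<And>p q. q \<in> closure D \<Longrightarrow> causal_cone (p - q) \<Longrightarrow> norm (p - q) \<le> C - mink p w"
    using past_bounded by metis
  have "norm q \<le> norm p + (C - mink p w)" if "q \<in> closure D" "causal_cone (p - q)" for q
    using C[OF that] norm_triangle_ineq3[of q p] by (simp add: norm_minus_commute)
  then have "bounded {q \<in> closure D. causal_cone (p - q)}" by (auto simp: bounded_iff)
  moreover have "closed ({q. causal_cone (p - q)} \<inter> closure D)"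
    by (intro closed_Int closed_causal_cone closed_closure)
  then have "closed {q \<in> closure D. causal_cone (p - q)}"
    by (simp add: Int_def conj_commute)
  ultimately show ?thesis by (simp add: compact_eq_bounded_closed)
qed

section \<open>The cosmological time as a maximum over the causal past\<close>

lemma exists_timelike_past:
  assumes "p \<in> D"
  obtains q where "q \<in> D" "future_timelike (p - q)"
proof -
  obtain e where e: "e > 0" "ball p e \<subseteq> D" using open_D assms open_contains_ball by blast
  have "p - (e / 2) *\<^sub>R time_axis \<in> ball p e" using e by (simp add: dist_norm norm_Pair)
  then show ?thesis using e by (intro that[of "p - (e / 2) *\<^sub>R time_axis"]) (auto simp: future_timelike_iff)
qed

text \<open>For \<open>q\<close> in \<open>D\<close> and \<open>p - q\<close> timelike, the segment
  stays in \<open>D\<close> by convexity and competes in the supremum. Other points of the closure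
  are reached by shrinking towards \<open>p\<close>, which scales \<open>p - q\<close> by
  \<open>1 - t\<close>, and letting \<open>t\<close> tend to 0.\<close>

lemma cosmological_time_ge:
  assumes "p \<in> D" "q \<in> closure D" "causal_cone (p - q)"
  shows "ereal (mink_len (p - q)) \<le> cosmological_time D p"
proof -
  have D: "ereal (mink_len (p - q)) \<le> cosmological_time D p"
    if q: "q \<in> D" and ft: "future_timelike (p - q)" for q
  proof -
    define c where "c = (\<lambda>t. q + t *\<^sub>R (p - q))"
    have fc: "future_causal (p - q)"
      using ft by (simp add: future_timelike_def future_causal_def)
    have "c t \<in> D" if "t \<in> {0..1}" for t
      using convexD_alt[OF convex_D q assms(1), of t] that by (simp add: c_def algebra_simps)
    then have "c \<in> {c. causal_curve c \<and> c ` {0..1} \<subseteq> D \<and> c 1 = p}"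
      using segment_causal_curve(1)[OF fc c_def] by (auto simp: c_def)
    then show ?thesis unfolding cosmological_time_def
      using segment_causal_curve(2)[OF fc c_def] by (metis (mono_tags, lifting) SUP_upper)
  qed
  show ?thesis
  proof (cases "future_timelike (p - q)")
    \<comment> \<open>The length is 0 here, but the supremum over an empty set would be minus
      infinity; a timelike past point supplies an actual curve.\<close>
    case False
    then have "mink_len (p - q) = 0"
      using assms(3) causal_cone_mink_nonpos[OF assms(3)] timelike_cone_iff[of "p - q"]
      by (simp add: mink_len_def)
    moreover obtain q' where q': "q' \<in> D" "future_timelike (p - q')"
      using exists_timelike_past[OF assms(1)] .
    ultimately have "ereal (mink_len (p - q)) \<le> ereal (mink_len (p - q'))"
      by (simp add: mink_len_nonneg causal_cone_timelike)
    then show ?thesis using D[OF q'] by (rule order_trans)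
  next
    case True
    have step: "ereal ((1 - t) * mink_len (p - q)) \<le> cosmological_time D p" if t: "0 < t" "t < 1" for t
    proof -
      define z where "z = q - t *\<^sub>R (q - p)"
      have "z \<in> D" using mem_interior_closure_convex_shrink[OF convex_D, of p q t] assms t
        by (simp add: z_def interior_open[OF open_D])
      moreover have pz: "p - z = (1 - t) *\<^sub>R (p - q)" by (simp add: z_def algebra_simps)
      moreover have "future_timelike (p - z)"
        using True t unfolding pz by (simp add: future_timelike_def mink_bilinear mult_pos_neg)
      ultimately show ?thesis using D[of z] t by (simp add: mink_len_scaleR)
    qed
    have "((\<lambda>t. ereal ((1 - t) * mink_len (p - q))) \<longlongrightarrow> ereal ((1 - 0) * mink_len (p - q))) (at_right 0)"
      by (intro tendsto_intros)
    moreover have "\<forall>\<^sub>F t in at_right 0. ereal ((1 - t) * mink_len (p - q)) \<le> cosmological_time D p"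
      using eventually_at_right_real[OF zero_less_one] by eventually_elim (simp add: step)
    ultimately have "ereal ((1 - 0) * mink_len (p - q)) \<le> cosmological_time D p"
      by (rule tendsto_upperbound) simp
    then show ?thesis by simp
  qed
qed

text \<open>Length is maximised over the compact causal past. A causal curve ending at
  \<open>p\<close> starts in that set and is no longer than its chord. A timelike past point in
  \<open>D\<close> makes the maximum positive, so the maximiser is timelike separated from
  \<open>p\<close>.\<close>

lemma time_attained:
  assumes "p \<in> D"
  shows "\<exists>r. r \<in> closure D \<and> future_timelike (p - r) \<and>
    cosmological_time D p = ereal (mink_len (p - r))"
proof -
  let ?K = "{q \<in> closure D. causal_cone (p - q)}"
  have "p \<in> ?K" using assms closure_subset by (auto simp: causal_cone_def)
  moreover have "continuous_on ?K (\<lambda>q. mink_len (p - q))"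
    unfolding mink_len_def by (intro continuous_intros)
  ultimately obtain r where r: "r \<in> ?K" "\<And>q. q \<in> ?K \<Longrightarrow> mink_len (p - q) \<le> mink_len (p - r)"
    using continuous_attains_sup[OF compact_past] by (metis (no_types, lifting) empty_iff)
  obtain q' where q': "q' \<in> D" "future_timelike (p - q')"
    using exists_timelike_past[OF assms] .
  then have "q' \<in> ?K" using closure_subset causal_cone_timelike[of "p - q'"] by auto
  then have "mink_len (p - q') \<le> mink_len (p - r)" by (rule r)
  moreover have "0 < mink_len (p - q')" using q' by (simp add: mink_len_def future_timelike_def)
  ultimately have "mink (p - r) (p - r) < 0" by (simp add: mink_len_def)
  then have "future_timelike (p - r)" using r(1) by (simp add: timelike_cone_iff)
  moreover have "cosmological_time D p \<le> ereal (mink_len (p - r))"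
    unfolding cosmological_time_def
  proof (rule SUP_least)
    fix c assume c: "c \<in> {c. causal_curve c \<and> c ` {0..1} \<subseteq> D \<and> c 1 = p}"
    then have "c 0 \<in> ?K" using causal_curve_length_le(1)[of c] closure_subset by force
    then have "mink_len (p - c 0) \<le> mink_len (p - r)" by (rule r)
    then show "ereal (lorentz_length c) \<le> ereal (mink_len (p - r))"
      using c causal_curve_length_le(2)[of c] by simp
  qed
  ultimately show ?thesis
    using cosmological_time_ge[OF assms, of r] r(1) by (intro exI[of _ r]) (auto intro: antisym)
qed

section \<open>The retraction, its supporting half-space, and concavity of the time function\<close>

definition retract :: "'n minkowski \<Rightarrow> 'n minkowski" where
  "retract p = (SOME r. r \<in> closure D \<and> future_timelike (p - r) \<and>
    cosmological_time D p = ereal (mink_len (p - r)))"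

definition tau :: "'n minkowski \<Rightarrow> real" where
  "tau p = mink_len (p - retract p)"

lemma
  assumes "p \<in> D"
  shows retract_closure: "retract p \<in> closure D"
    and retract_timelike: "future_timelike (p - retract p)"
    and cosmological_time_eq: "cosmological_time D p = ereal (tau p)"
  using someI_ex[OF time_attained[OF assms]] unfolding retract_def[symmetric] tau_def by auto

lemma retract_causal: "p \<in> D \<Longrightarrow> causal_cone (p - retract p)"
  by (simp add: retract_timelike causal_cone_timelike)

lemma tau_pos: "p \<in> D \<Longrightarrow> 0 < tau p"
  using retract_timelike[of p] by (simp add: tau_def mink_len_def future_timelike_def)

lemma tau_sq: "p \<in> D \<Longrightarrow> (tau p)\<^sup>2 = - mink (p - retract p) (p - retract p)"
  by (simp add: tau_def mink_len_sq retract_causal)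

lemma tau_ge: "p \<in> D \<Longrightarrow> q \<in> closure D \<Longrightarrow> causal_cone (p - q) \<Longrightarrow> mink_len (p - q) \<le> tau p"
  using cosmological_time_ge[of p q] by (simp add: cosmological_time_eq)

lemma level_set_eq: "level_set D \<epsilon> = {p \<in> D. tau p = \<epsilon>}"
  by (auto simp: level_set_def cosmological_time_eq)

text \<open>First-order optimality: moving the maximiser slightly towards \<open>q\<close> cannot
  lengthen \<open>p - retract p\<close>. Dividing by the step \<open>a\<close> and letting it tend
  to 0 leaves a supporting half-space of \<open>closure D\<close> at
  \<open>retract p\<close>.\<close>

lemma retract_variational:
  assumes p: "p \<in> D" and q: "q \<in> closure D"
  shows "mink (p - retract p) (q - retract p) \<le> 0"
proof -
  define y d where "y = p - retract p" and "d = q - retract p"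
  have "((\<lambda>a. y - a *\<^sub>R d) \<longlongrightarrow> y - 0 *\<^sub>R d) (at_right 0)" by (intro tendsto_intros)
  then have "\<forall>\<^sub>F a in at_right 0. y - a *\<^sub>R d \<in> Collect future_timelike"
    using retract_timelike[OF p] by (intro topological_tendstoD[OF _ open_future_timelike]) (auto simp: y_def)
  then have ev: "\<forall>\<^sub>F a in at_right 0. 2 * mink y d \<le> a * mink d d"
    using eventually_at_right_real[OF zero_less_one]
  proof eventually_elim
    case (elim a)
    then have J: "causal_cone (y - a *\<^sub>R d)" by (simp add: causal_cone_timelike)
    have "(1 - a) *\<^sub>R retract p + a *\<^sub>R q \<in> closure D"
      using convexD_alt[OF convex_closure[OF convex_D] retract_closure[OF p] q, of a] elim by simp
    moreover have "p - ((1 - a) *\<^sub>R retract p + a *\<^sub>R q) = y - a *\<^sub>R d"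
      by (simp add: y_def d_def algebra_simps)
    ultimately have "mink_len (y - a *\<^sub>R d) \<le> tau p" using tau_ge[OF p] J by metis
    then have "(mink_len (y - a *\<^sub>R d))\<^sup>2 \<le> (tau p)\<^sup>2"
      using mink_len_nonneg[OF J] by (rule power_mono)
    then have "a * (2 * mink y d) \<le> a * (a * mink d d)"
      using tau_sq[OF p] mink_len_sq[OF J] mink_commute[of y d]
      by (simp add: y_def[symmetric] mink_bilinear algebra_simps)
    then show ?case using elim by simp
  qed
  have "((\<lambda>a. a * mink d d) \<longlongrightarrow> 0 * mink d d) (at_right 0)" by (intro tendsto_intros)
  from tendsto_lowerbound[OF this ev] show ?thesis by (simp add: y_def d_def)
qed

text \<open>Reverse Cauchy-Schwarz handles the two displacements, and
  \<open>retract_variational\<close> then replaces \<open>retract p'\<close> by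
  \<open>retract p\<close>. Divided by \<open>tau p\<close>, the right side is an affine majorant of
  \<open>tau\<close> touching it at \<open>p\<close>.\<close>

lemma tau_supergradient:
  assumes p: "p \<in> D" and p': "p' \<in> D"
  shows "tau p * tau p' \<le> - mink (p - retract p) (p' - retract p)"
proof -
  have "tau p * tau p' \<le> - mink (p - retract p) (p' - retract p')"
    unfolding tau_def using p p' by (intro reverse_cauchy_schwarz retract_causal)
  also have "\<dots> \<le> - mink (p - retract p) (p' - retract p)"
    using retract_variational[OF p retract_closure[OF p']] by (simp add: mink_bilinear)
  finally show ?thesis .
qed

text \<open>The convex combination of the two retractions competes for the intermediate point, and
  the reverse triangle inequality compares lengths. Continuity of \<open>tau\<close> on the open set
  \<open>D\<close> is drawn from this.\<close>

lemma tau_concave: "convex_on D (\<lambda>p. - tau p)"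
proof (rule convex_onI[OF _ convex_D])
  fix t :: real and p q assume t: "0 < t" "t < 1" and p: "p \<in> D" and q: "q \<in> D"
  let ?z = "(1 - t) *\<^sub>R p + t *\<^sub>R q" and ?r = "(1 - t) *\<^sub>R retract p + t *\<^sub>R retract q"
  have eq: "?z - ?r = (1 - t) *\<^sub>R (p - retract p) + t *\<^sub>R (q - retract q)"
    by (simp add: algebra_simps)
  have J: "causal_cone ((1 - t) *\<^sub>R (p - retract p))" "causal_cone (t *\<^sub>R (q - retract q))"
    using t p q by (auto intro!: causal_cone_scaleR retract_causal)
  have "(1 - t) * tau p + t * tau q \<le> mink_len (?z - ?r)"
    using reverse_triangle[OF J] t unfolding eq by (simp add: mink_len_scaleR tau_def)
  also have "\<dots> \<le> tau ?z"
  proof (rule tau_ge)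
    show "?z \<in> D" using convexD_alt[OF convex_D p q, of t] t by simp
    show "?r \<in> closure D"
      using convexD_alt[OF convex_closure[OF convex_D] retract_closure[OF p] retract_closure[OF q], of t] t
      by simp
    show "causal_cone (?z - ?r)" unfolding eq using J by (rule causal_cone_add)
  qed
  finally show "- tau ?z \<le> (1 - t) * (- tau p) + t * (- tau q)" by simp
qed

lemma continuous_on_tau: "continuous_on D tau"
  using continuous_on_minus[OF convex_on_continuous[OF open_D tau_concave]] by simp


end

section \<open>Level sets, their normals, and the functions iota\<close>

lemma abs_mink_le: "\<bar>mink a b\<bar> \<le> norm a * norm b"
proof -
  have "mink a b = (- fst a, snd a) \<bullet> b" by (simp add: mink_def inner_prod_def)
  moreover have "norm (- fst a, snd a) = norm a" by (simp add: norm_prod_def)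
  ultimately show ?thesis using Cauchy_Schwarz_ineq2[of "(- fst a, snd a)" b] by simp
qed

lemma mono_on_tendsto_INF_at_right:
  fixes f :: "real \<Rightarrow> real"
  assumes mono: "mono_on {a<..} f" and bdd: "bdd_below (f ` {a<..})"
  shows "(f \<longlongrightarrow> (INF x\<in>{a<..}. f x)) (at_right a)"
proof (rule order_tendstoI)
  fix b assume "b < (INF x\<in>{a<..}. f x)"
  then have "b < f x" if "x > a" for x
    using cINF_lower[OF bdd, of x] that by simp
  then show "\<forall>\<^sub>F x in at_right a. b < f x"
    using eventually_at_right_less[of a] by (rule eventually_mono[rotated])
next
  fix b assume "(INF x\<in>{a<..}. f x) < b"
  then obtain e where e: "e > a" "f e < b"
    using cINF_less_iff[OF _ bdd, of b] by auto
  show "\<forall>\<^sub>F x in at_right a. f x < b"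
    using eventually_at_right_real[OF e(1)]
  proof eventually_elim
    case (elim x)
    then have "f x \<le> f e" using e(1) by (intro mono_onD[OF mono]) auto
    then show ?case using e(2) by simp
  qed
qed

section \<open>Level sets as entire graphs in direction \<open>v\<close>, and their normals\<close>

context dependence_domain
begin

text \<open>\<open>retract p\<close> still competes for the higher point, and \<open>v\<close> has
  length 1. This growth lets a line in direction \<open>v\<close> meet each level set at most
  once.\<close>

lemma tau_add:
  assumes v: "future_timelike v" "mink v v = -1" and p: "p \<in> D" and \<delta>: "0 \<le> \<delta>"
  shows "p + \<delta> *\<^sub>R v \<in> D" and "tau p + \<delta> \<le> tau (p + \<delta> *\<^sub>R v)"
proof -
  have J: "causal_cone (\<delta> *\<^sub>R v)" using v \<delta> by (simp add: causal_cone_scaleR causal_cone_timelike)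
  show D: "p + \<delta> *\<^sub>R v \<in> D" by (rule add_causal[OF p J])
  have eq: "p - retract p + \<delta> *\<^sub>R v = p + \<delta> *\<^sub>R v - retract p" by simp
  have "mink_len v = 1" using v by (simp add: mink_len_def)
  then have "tau p + \<delta> \<le> mink_len (p + \<delta> *\<^sub>R v - retract p)"
    using reverse_triangle[OF retract_causal[OF p] J] \<delta> unfolding eq
    by (simp add: tau_def mink_len_scaleR)
  also have "\<dots> \<le> tau (p + \<delta> *\<^sub>R v)"
    using causal_cone_add[OF retract_causal[OF p] J] unfolding eq
    by (intro tau_ge D retract_closure p)
  finally show "tau p + \<delta> \<le> tau (p + \<delta> *\<^sub>R v)" .
qed

text \<open>The boundary point of the line lies on a null hyperplane missing the domain, which
  forces the past of nearby points into a thin slab.\<close>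

lemma tau_small_on_line:
  assumes v: "future_timelike v" and "0 < \<epsilon>"
  shows "\<exists>s. x + s *\<^sub>R v \<in> D \<and> tau (x + s *\<^sub>R v) \<le> \<epsilon>"
proof -
  define A where "A = (\<lambda>s. x + s *\<^sub>R v) -` D"
  obtain C u where u: "future_timelike u"
    "\<And>p q. q \<in> closure D \<Longrightarrow> causal_cone (p - q) \<Longrightarrow> norm (p - q) \<le> C - mink p u"
    using past_bounded by metis
  have vu: "mink v u < 0"
    using v by (intro timelike_mink_neg[OF u(1)]) (auto simp: causal_cone_timelike future_timelike_def)
  have A_up: "t \<in> A" if "s \<in> A" "s \<le> t" for s t
  proof -
    have "causal_cone ((t - s) *\<^sub>R v)" using that v by (simp add: causal_cone_scaleR causal_cone_timelike)
    then show ?thesis using add_causal[of "x + s *\<^sub>R v" "(t - s) *\<^sub>R v"] that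
      by (simp add: A_def algebra_simps)
  qed
  obtain d where d: "d \<in> D" using nonempty by auto
  have "A \<noteq> {}"
  proof -
    define g where "g = fst v - norm (snd v)"
    have g: "g > 0" using v by (simp add: g_def future_timelike_iff)
    \<comment> \<open>Along \<open>v\<close> the time component outgrows the spatial norm at rate
      \<open>g\<close>; this \<open>s\<close> makes up for the initial deficit of
      \<open>x - d\<close>.\<close>
    define s where "s = (norm (snd (x - d)) + \<bar>fst (x - d)\<bar>) / g"
    have s: "s \<ge> 0" "s * g = norm (snd (x - d)) + \<bar>fst (x - d)\<bar>" using g by (simp_all add: s_def)
    have "norm (snd (x - d + s *\<^sub>R v)) \<le> norm (snd (x - d)) + s * norm (snd v)"
      using norm_triangle_ineq[of "snd (x - d)" "s *\<^sub>R snd v"] s(1) by simp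
    also have "\<dots> \<le> fst (x - d + s *\<^sub>R v)"
      using s(2) by (simp add: g_def algebra_simps)
    finally have "causal_cone (x - d + s *\<^sub>R v)" by (simp add: causal_cone_def)
    from add_causal[OF d this] show ?thesis by (auto simp: A_def)
  qed
  have bdd: "bdd_below A"
  proof (rule bdd_belowI)
    fix s assume "s \<in> A"
    then have "x + s *\<^sub>R v \<in> closure D" using closure_subset by (auto simp: A_def)
    from u(2)[OF this, of "x + s *\<^sub>R v"] show "(mink x u - C) / - mink v u \<le> s"
      using vu by (simp add: causal_cone_def mink_bilinear field_simps)
  qed
  define s0 where "s0 = Inf A"
  have "open A" unfolding A_def
    by (intro open_vimage open_D continuous_intros)
  have "s0 \<notin> A"
  proof
    assume "s0 \<in> A"
    then obtain e where e: "e > 0" "ball s0 e \<subseteq> A"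
      using \<open>open A\<close> open_contains_ball by blast
    then have "s0 - e / 2 \<in> A" by (auto simp: subset_iff dist_real_def)
    then have "s0 \<le> s0 - e / 2" unfolding s0_def by (rule cInf_lower[OF _ bdd])
    then show False using e by simp
  qed
  define p0 where "p0 = x + s0 *\<^sub>R v"
  have "p0 \<notin> D" using \<open>s0 \<notin> A\<close> by (simp add: A_def p0_def)
  then obtain w c where w: "0 < fst w" "norm (snd w) = fst w" "causal_cone w"
      "\<And>q. q \<in> D \<Longrightarrow> mink q w < c" "c \<le> mink p0 w"
    using hyperplane_separates by metis
  \<comment> \<open>For a step \<open>\<delta> \<le> 1\<close> above \<open>p0\<close>,
    \<open>B\<close> bounds the displacement \<open>y\<close> from the retraction and
    \<open>\<delta> * a\<close> bounds \<open>- mink w y\<close>. Together they give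
    \<open>(tau p)^2 \<le> \<delta> * M\<close>; the summand 1 keeps \<open>M\<close>
    positive.\<close>
  define a B M where "a = - mink v w" and "B = C - mink p0 u - mink v u"
    and "M = \<bar>2 * a * B / fst w\<bar> + 1"
  define \<delta> where "\<delta> = min 1 (\<epsilon>\<^sup>2 / M)"
  have M: "M > 0" unfolding M_def by (rule add_nonneg_pos) auto
  have \<delta>: "0 < \<delta>" "\<delta> \<le> 1" using assms(2) M by (auto simp: \<delta>_def)
  have "\<delta> * M \<le> \<epsilon>\<^sup>2" using M by (simp add: \<delta>_def min_def field_simps)
  define p where "p = p0 + \<delta> *\<^sub>R v"
  have peq: "p = x + (s0 + \<delta>) *\<^sub>R v" by (simp add: p_def p0_def algebra_simps)
  obtain s1 where "s1 \<in> A" "s1 < s0 + \<delta>"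
    using cInf_lessD[OF \<open>A \<noteq> {}\<close>, of "s0 + \<delta>"] \<delta> by (auto simp: s0_def)
  then have pD: "p \<in> D" using A_up[of s1 "s0 + \<delta>"] by (simp add: A_def peq)
  define y where "y = p - retract p"
  have J: "causal_cone y" using pD by (simp add: y_def retract_causal)
  have "norm y \<le> C - mink p u" unfolding y_def
    using u(2) retract_closure[OF pD] retract_causal[OF pD] by blast
  also have "\<dots> \<le> B" using vu mult_right_mono_neg[OF \<delta>(2), of "mink v u"]
    by (simp add: p_def B_def mink_bilinear)
  finally have "norm y \<le> B" .
  then have yB: "fst y \<le> B" using norm_fst_le[of "fst y" "snd y"] by simp
  \<comment> \<open>The retraction lies on the domain side of the null hyperplane and
    \<open>p0\<close> does not lie strictly inside, so only the step \<open>\<delta>\<close> can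
    make \<open>mink y w\<close> negative.\<close>
  have "mink (retract p) w \<le> c"
    by (rule closure_halfspace[OF less_imp_le[OF w(4)] retract_closure[OF pD]])
  moreover have "mink y w = mink p0 w + \<delta> * mink v w - mink (retract p) w"
    unfolding y_def mink_bilinear(2) p_def mink_bilinear(1,4) ..
  ultimately have "- mink w y \<le> \<delta> * a"
    using w(5) mink_commute[of w y] by (simp add: a_def)
  then have "fst w * (fst y - norm (snd y)) \<le> \<delta> * a"
    using mink_cone_ge[OF w(3), of y] by simp
  then have gap: "fst y - norm (snd y) \<le> \<delta> * a / fst w"
    using w(1) by (simp add: field_simps)
  have nn: "0 \<le> fst y - norm (snd y)" "0 \<le> fst y"
    using J causal_cone_fst_nonneg by (auto simp: causal_cone_def)
  have "(tau p)\<^sup>2 = (fst y - norm (snd y)) * (fst y + norm (snd y))"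
    using tau_sq[OF pD] by (simp add: y_def[symmetric] mink_self algebra_simps power2_eq_square)
  also have "\<dots> \<le> (\<delta> * a / fst w) * (2 * B)"
    using gap nn yB by (intro mult_mono) auto
  also have "\<dots> = \<delta> * (2 * a * B / fst w)" by simp
  also have "\<dots> \<le> \<delta> * M" 
  proof (rule mult_left_mono)
    show "2 * a * B / fst w \<le> M" unfolding M_def by (rule order_trans[OF abs_ge_self]) simp
  qed (use \<delta>(1) in simp)
  also have "\<dots> \<le> \<epsilon>\<^sup>2" by fact
  finally have "tau p \<le> \<epsilon>" by (rule power2_le_imp_le) (simp add: less_imp_le[OF assms(2)])
  then show ?thesis using pD peq by metis
qed

text \<open>From a point where \<open>tau\<close> is small, growth at unit speed or more passes
  \<open>\<epsilon>\<close> within a further distance \<open>\<epsilon>\<close>. Continuity gives a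
  crossing, and the same growth excludes a second one.\<close>

lemma level_set_meets_line:
  assumes v: "future_timelike v" "mink v v = -1" and "0 < \<epsilon>"
  shows "\<exists>!s. x + s *\<^sub>R v \<in> level_set D \<epsilon>"
proof -
  obtain s1 where s1: "x + s1 *\<^sub>R v \<in> D" "tau (x + s1 *\<^sub>R v) \<le> \<epsilon>"
    using tau_small_on_line[OF v(1) assms(3)] by blast
  have up: "x + t *\<^sub>R v \<in> D" "tau (x + s *\<^sub>R v) + (t - s) \<le> tau (x + t *\<^sub>R v)"
    if "x + s *\<^sub>R v \<in> D" "s \<le> t" for s t
    using tau_add[OF v that(1), of "t - s"] that(2) by (simp_all add: algebra_simps)
  have "continuous_on {s1..s1 + \<epsilon>} (\<lambda>s. tau (x + s *\<^sub>R v))"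
    by (rule continuous_on_compose2[OF continuous_on_tau])
      (auto intro!: continuous_intros up(1)[OF s1(1)])
  moreover have "\<epsilon> \<le> tau (x + (s1 + \<epsilon>) *\<^sub>R v)"
    using up(2)[OF s1(1), of "s1 + \<epsilon>"] assms(3) tau_pos[OF s1(1)] by simp
  ultimately obtain s where s: "s1 \<le> s" "tau (x + s *\<^sub>R v) = \<epsilon>"
    using IVT'[of "\<lambda>s. tau (x + s *\<^sub>R v)" s1 \<epsilon> "s1 + \<epsilon>"] s1(2) assms(3) by auto
  show ?thesis
  proof (rule ex1I[of _ s])
    show "x + s *\<^sub>R v \<in> level_set D \<epsilon>" using s up(1)[OF s1(1)] by (simp add: level_set_eq)
    fix t assume "x + t *\<^sub>R v \<in> level_set D \<epsilon>"
    then have t: "x + t *\<^sub>R v \<in> D" "tau (x + t *\<^sub>R v) = \<epsilon>" by (auto simp: level_set_eq)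
    show "t = s"
      using up(2)[OF up(1)[OF s1(1) s(1)], of t] up(2)[OF t(1), of s] t(2) s(2)
      by (cases "s \<le> t") auto
  qed
qed

lemma graph_fun_level:
  assumes "future_timelike v" "mink v v = -1" "0 < \<epsilon>"
  shows "x + graph_fun D v \<epsilon> x *\<^sub>R v \<in> D" "tau (x + graph_fun D v \<epsilon> x *\<^sub>R v) = \<epsilon>"
  using theI'[OF level_set_meets_line[OF assms, of x]] unfolding graph_fun_def[symmetric]
  by (auto simp: level_set_eq)

lemma graph_fun_tau:
  assumes "future_timelike v" "mink v v = -1" "x + s *\<^sub>R v \<in> D"
  shows "graph_fun D v (tau (x + s *\<^sub>R v)) x = s"
  unfolding graph_fun_def
  by (rule the1_equality[OF level_set_meets_line[OF assms(1,2)]])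
    (use assms in \<open>auto simp: tau_pos level_set_eq\<close>)

lemma graph_fun_le:
  assumes v: "future_timelike v" "mink v v = -1" "0 < \<epsilon>"
    and "x + s *\<^sub>R v \<in> D" "\<epsilon> \<le> tau (x + s *\<^sub>R v)"
  shows "graph_fun D v \<epsilon> x \<le> s"
proof (rule ccontr)
  let ?g = "graph_fun D v \<epsilon> x"
  assume "\<not> ?g \<le> s"
  then have "tau (x + s *\<^sub>R v) + (?g - s) \<le> tau (x + s *\<^sub>R v + (?g - s) *\<^sub>R v)"
    by (intro tau_add(2)[OF v(1,2) assms(4)]) simp
  also have "x + s *\<^sub>R v + (?g - s) *\<^sub>R v = x + ?g *\<^sub>R v" by (simp add: algebra_simps)
  finally show False using graph_fun_level[OF v, of x] assms(5) \<open>\<not> ?g \<le> s\<close> by simp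
qed

text \<open>The supergradient puts the level set on one side of the candidate tangent plane, and the
  hyperboloid around the retraction bounds it quadratically from the other side.\<close>

lemma tangent_vectors_level_set:
  assumes p: "p \<in> D"
  shows "tangent_vectors (level_set D (tau p)) p = {w. mink (p - retract p) w = 0}"
proof (intro set_eqI iffI)
  define y where "y = p - retract p"
  fix w assume "w \<in> tangent_vectors (level_set D (tau p)) p"
  then obtain \<gamma> e where \<gamma>: "e > 0" "\<gamma> ` {-e<..<e} \<subseteq> level_set D (tau p)" "\<gamma> 0 = p"
      "(\<gamma> has_vector_derivative w) (at 0)"
    by (auto simp: tangent_vectors_def)
  have "linear (mink y)" by (rule linearI) (simp_all add: mink_bilinear)
  then have "bounded_linear (mink y)" by (simp add: linear_conv_bounded_linear)
  from bounded_linear.has_vector_derivative[OF this \<gamma>(4)]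
  have der: "((\<lambda>t. mink y (\<gamma> t)) has_real_derivative mink y w) (at 0)"
    by (simp add: has_real_derivative_iff_has_vector_derivative)
  \<comment> \<open>The affine majorant of \<open>tau\<close> confines the curve to one side of the
    plane, so this product has a local maximum at 0 and its derivative vanishes.\<close>
  have "mink y (\<gamma> t) \<le> mink y (\<gamma> 0)" if "\<bar>0 - t\<bar> < e" for t
  proof -
    have "t \<in> {-e<..<e}" using that by auto
    then have "\<gamma> t \<in> level_set D (tau p)" using \<gamma>(2) by blast
    then have "\<gamma> t \<in> D" "tau (\<gamma> t) = tau p" by (auto simp: level_set_eq)
    then have "(tau p)\<^sup>2 \<le> - mink y (\<gamma> t - retract p)"
      using tau_supergradient[OF p, of "\<gamma> t"] by (simp add: y_def power2_eq_square)
    then show ?thesis using tau_sq[OF p] \<gamma>(3) unfolding y_def[symmetric]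
      by (simp add: mink_bilinear) (simp add: y_def mink_bilinear)
  qed
  then have "mink y w = 0" using DERIV_local_max[OF der \<gamma>(1)] by blast
  then show "w \<in> {w. mink (p - retract p) w = 0}" by (simp add: y_def)
next
  define y where "y = p - retract p"
  define v :: "'n minkowski" where "v = time_axis"
  have v: "future_timelike v" "mink v v = -1" by (simp_all add: v_def)
  fix w assume "w \<in> {w. mink (p - retract p) w = 0}"
  then have yw: "mink y w = 0" by (simp add: y_def)
  have ft: "future_timelike y" using p by (simp add: y_def retract_timelike)
  define i where "i = - mink y v"
  have "y \<noteq> 0" using ft by (auto simp: future_timelike_iff)
  then have i: "i > 0"
    using timelike_mink_neg[OF v(1) causal_cone_timelike[OF ft]] by (simp add: i_def)
  \<comment> \<open>The curve lifts the line \<open>p + t *\<^sub>R w\<close> to the level set. Its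
    velocity is \<open>w\<close> because the height \<open>s t\<close> is squeezed between 0 and a
    multiple of \<open>t^2\<close>.\<close>
  define s where "s t = graph_fun D v (tau p) (p + t *\<^sub>R w)" for t
  define \<gamma> where "\<gamma> t = p + t *\<^sub>R w + s t *\<^sub>R v" for t
  have \<gamma>D: "\<gamma> t \<in> D" "tau (\<gamma> t) = tau p" for t
    unfolding \<gamma>_def s_def using graph_fun_level[OF v tau_pos[OF p]] by auto
  have s0: "s 0 = 0" using graph_fun_tau[OF v, of p 0] p by (simp add: s_def)
  have s_nonneg: "0 \<le> s t" for t
  proof -
    have "(tau p)\<^sup>2 \<le> - mink y (\<gamma> t - retract p)"
      using tau_supergradient[OF p \<gamma>D(1)] \<gamma>D(2) by (simp add: y_def power2_eq_square)
    also have "\<gamma> t - retract p = y + t *\<^sub>R w + s t *\<^sub>R v" by (simp add: \<gamma>_def y_def)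
    finally have "0 \<le> s t * i" using tau_sq[OF p] yw
      unfolding y_def[symmetric] by (simp add: mink_bilinear i_def)
    then show ?thesis using i by (simp add: zero_le_mult_iff)
  qed
  \<comment> \<open>\<open>2 * B * i\<close> has to exceed \<open>mink w w\<close>, so that the
    coefficient \<open>g\<close> of \<open>t^2\<close> in the squared length of
    \<open>z t - retract p\<close> is positive near 0.\<close>
  define B where "B = (\<bar>mink w w\<bar> + 1) / (2 * i)"
  have B: "2 * B * i = \<bar>mink w w\<bar> + 1" using i by (simp add: B_def)
  define z where "z t = p + t *\<^sub>R w + (B * t\<^sup>2) *\<^sub>R v" for t
  define g where "g t = - mink w w + B\<^sup>2 * t\<^sup>2 + 2 * B * i - 2 * B * t * mink w v" for t
  have "(z \<longlongrightarrow> p + 0 *\<^sub>R w + (B * 0\<^sup>2) *\<^sub>R v) (at 0)"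
    unfolding z_def by (intro tendsto_intros)
  then have zlim: "(z \<longlongrightarrow> p) (at 0)" by simp
  have "(g \<longlongrightarrow> - mink w w + B\<^sup>2 * 0\<^sup>2 + 2 * B * i - 2 * B * 0 * mink w v) (at 0)"
    unfolding g_def by (intro tendsto_intros)
  then have "\<forall>\<^sub>F t in at 0. 0 < g t"
    by (rule order_tendstoD) (simp add: B)
  moreover have "\<forall>\<^sub>F t in at 0. z t \<in> D" by (rule topological_tendstoD[OF zlim open_D p])
  moreover have "\<forall>\<^sub>F t in at 0. z t - retract p \<in> Collect future_timelike"
    using ft by (intro topological_tendstoD[OF tendsto_diff[OF zlim tendsto_const] open_future_timelike])
      (simp add: y_def)
  \<comment> \<open>\<open>z t\<close> lies beyond the hyperboloid of radius \<open>tau p\<close>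
    around \<open>retract p\<close>, hence \<open>tau (z t)\<close> is at least \<open>tau p\<close>
    and the level set passes at or below \<open>z t\<close>.\<close>
  ultimately have s_le: "\<forall>\<^sub>F t in at 0. s t \<le> B * t\<^sup>2"
  proof eventually_elim
    case (elim t)
    then have J: "causal_cone (z t - retract p)" by (simp add: causal_cone_timelike)
    have zeq: "z t - retract p = y + t *\<^sub>R w + (B * t\<^sup>2) *\<^sub>R v" by (simp add: z_def y_def)
    have "- mink (z t - retract p) (z t - retract p) = (tau p)\<^sup>2 + t\<^sup>2 * g t"
      unfolding zeq g_def tau_sq[OF p] y_def[symmetric] using yw v(2)
      by (simp add: mink_bilinear i_def mink_commute[of w y] mink_commute[of v y] mink_commute[of v w]
          algebra_simps power2_eq_square)
    then have "(tau p)\<^sup>2 \<le> (mink_len (z t - retract p))\<^sup>2"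
      using elim mink_len_sq[OF J] by simp
    then have "tau p \<le> mink_len (z t - retract p)"
      by (rule power2_le_imp_le) (rule mink_len_nonneg[OF J])
    also have "\<dots> \<le> tau (z t)" using elim J by (intro tau_ge retract_closure p) auto
    finally show ?case unfolding s_def using elim v tau_pos[OF p]
      by (intro graph_fun_le) (auto simp: z_def)
  qed
  have "(s has_real_derivative 0) (at 0)" unfolding DERIV_def
  proof (rule Lim_null_comparison)
    show "((\<lambda>h. B * \<bar>h\<bar>) \<longlongrightarrow> 0) (at 0)" by (auto intro!: tendsto_eq_intros)
    have "\<forall>\<^sub>F h in at (0::real). h \<noteq> 0" by (simp add: eventually_at_filter)
    with s_le show "\<forall>\<^sub>F h in at 0. norm ((s (0 + h) - s 0) / h) \<le> B * \<bar>h\<bar>"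
    proof eventually_elim
      case (elim h)
      have "h\<^sup>2 = \<bar>h\<bar> * \<bar>h\<bar>" by (simp add: power2_eq_square)
      then have "s h \<le> B * \<bar>h\<bar> * \<bar>h\<bar>" using elim by simp
      then show ?case using elim s_nonneg[of h] by (simp add: s0 abs_divide pos_divide_le_eq)
    qed
  qed
  then have "(\<gamma> has_vector_derivative w) (at 0)" unfolding \<gamma>_def
    by (auto intro!: derivative_eq_intros)
  then show "w \<in> tangent_vectors (level_set D (tau p)) p"
    unfolding tangent_vectors_def using \<gamma>D s0
    by (auto intro!: exI[of _ \<gamma>] exI[of _ "1::real"] simp: level_set_eq \<gamma>_def)
qed

lemma future_unit_normal_eq:
  assumes p: "p \<in> D"
  shows "future_unit_normal (level_set D (tau p)) p = (1 / tau p) *\<^sub>R (p - retract p)"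
    (is "_ = ?n")
proof -
  have pos: "0 < tau p" using p by (rule tau_pos)
  have "mink ?n ?n = mink (p - retract p) (p - retract p) / (tau p)\<^sup>2"
    by (simp only: mink_bilinear(4,8)) (simp add: power2_eq_square)
  also have "mink (p - retract p) (p - retract p) = - (tau p)\<^sup>2" using tau_sq[OF p] by simp
  finally have nn: "mink ?n ?n = -1" using pos by simp
  have "fst ?n > 0" using retract_timelike[OF p] pos by (simp add: future_timelike_def)
  then have ft: "future_timelike ?n" unfolding future_timelike_def nn by simp
  have orth: "mink ?n w = 0 \<longleftrightarrow> mink (p - retract p) w = 0" for w
    unfolding mink_bilinear(4) using pos by simp
  show ?thesis unfolding future_unit_normal_def tangent_vectors_level_set[OF p]
  proof (rule the_equality)
    show "future_timelike ?n \<and> mink ?n ?n = - 1 \<and> (\<forall>w\<in>{w. mink (p - retract p) w = 0}. mink ?n w = 0)"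
      using ft nn orth by blast
  next
    fix m assume "future_timelike m \<and> mink m m = - 1 \<and> (\<forall>w\<in>{w. mink (p - retract p) w = 0}. mink m w = 0)"
    then show "m = ?n" using orth by (intro unit_normal_unique[OF ft nn]) auto
  qed
qed

text \<open>The factor \<open>\<epsilon>\<close> in \<open>iota_eps\<close> cancels the
  normalisation of \<open>p - retract p\<close> to a unit normal. What remains is the height of the
  point over its retraction in direction \<open>v\<close>.\<close>

lemma iota_eps_tau:
  assumes "future_timelike v" "mink v v = -1" "x + s *\<^sub>R v \<in> D"
  shows "iota_eps D v (tau (x + s *\<^sub>R v)) x = - mink (x + s *\<^sub>R v - retract (x + s *\<^sub>R v)) v"
  unfolding iota_eps_def graph_fun_tau[OF assms] future_unit_normal_eq[OF assms(3)] mink_bilinear(4)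
  using tau_pos[OF assms(3)] by simp

text \<open>Each of the two retractions is used as a competitor for the other point.\<close>

lemma retract_height_mono:
  assumes v: "future_timelike v" "mink v v = -1" and p: "p \<in> D" and \<delta>: "0 < \<delta>"
  defines "p' \<equiv> p + \<delta> *\<^sub>R v"
  shows "- mink (p - retract p) v + \<delta> \<le> - mink (p' - retract p') v"
proof -
  have p': "p' \<in> D" and tau': "tau p + \<delta> \<le> tau p'"
    using tau_add[OF v p] \<delta> by (auto simp: p'_def)
  define y y' where "y = p - retract p" and "y' = p' - retract p'"
  have J: "causal_cone y" "causal_cone y'" using p p' by (auto simp: y_def y'_def retract_causal)
  have Jv: "causal_cone (\<delta> *\<^sub>R v)" using v \<delta> by (simp add: causal_cone_scaleR causal_cone_timelike)
  have Jy: "causal_cone (y + \<delta> *\<^sub>R v)" using J(1) Jv by (rule causal_cone_add)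
  have "p' - retract p = y + \<delta> *\<^sub>R v" by (simp add: p'_def y_def)
  then have "mink_len (y + \<delta> *\<^sub>R v) \<le> tau p'"
    using tau_ge[OF p' retract_closure[OF p]] Jy by simp
  then have "(mink_len (y + \<delta> *\<^sub>R v))\<^sup>2 \<le> (tau p')\<^sup>2"
    using mink_len_nonneg[OF Jy] by (rule power_mono)
  then have 1: "- mink (y + \<delta> *\<^sub>R v) (y + \<delta> *\<^sub>R v) \<le> - mink y' y'"
    using mink_len_sq[OF Jy] tau_sq[OF p'] by (simp add: y'_def)
  define z where "z = y' - \<delta> *\<^sub>R v"
  have z: "p - retract p' = z" by (simp add: z_def p'_def y'_def)
  \<comment> \<open>\<open>retract p'\<close> competes for \<open>p\<close> only if \<open>z\<close>
    is causal. Otherwise either signs suffice, or \<open>- z\<close> is causal and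
    \<open>tau p' \<le> \<delta>\<close>, contradicting the growth of \<open>tau\<close>.\<close>
  have 2: "- mink z z \<le> - mink y y"
  proof -
    consider "mink z z \<ge> 0" | "causal_cone z" | "causal_cone (- z)"
      using causal_coneI[of z] causal_coneI[of "- z"] by (force simp: mink_bilinear)
    then show ?thesis
    proof cases
      case 1
      then show ?thesis using causal_cone_mink_nonpos[OF J(1)] by linarith
    next
      case 2
      then have "mink_len z \<le> tau p" using tau_ge[OF p retract_closure[OF p']] z by simp
      then have "(mink_len z)\<^sup>2 \<le> (tau p)\<^sup>2" using mink_len_nonneg[OF 2] by (rule power_mono)
      then show ?thesis using mink_len_sq[OF 2] tau_sq[OF p] by (simp add: y_def)
    next
      case 3
      have "mink_len (- z) + mink_len y' \<le> mink_len (- z + y')"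
        using 3 J(2) by (rule reverse_triangle)
      also have "- z + y' = \<delta> *\<^sub>R v" by (simp add: z_def)
      also have "mink_len (\<delta> *\<^sub>R v) = \<delta>" using \<delta> v by (simp add: mink_len_scaleR) (simp add: mink_len_def)
      finally have "tau p' \<le> \<delta>" using mink_len_nonneg[OF 3] by (simp add: tau_def y'_def)
      then show ?thesis using tau' tau_pos[OF p] by simp
    qed
  qed
  \<comment> \<open>Adding the two inequalities cancels the squared lengths of \<open>y\<close> and
    \<open>y'\<close>; what is left is the claim multiplied by \<open>2 * \<delta>\<close>.\<close>
  from 1 2 have "\<delta> * (- mink y v + \<delta>) \<le> \<delta> * (- mink y' v)"
    using v(2) mink_commute[of v y] mink_commute[of v y']
    by (simp add: z_def mink_bilinear algebra_simps)
  then show ?thesis unfolding y_def y'_def by (simp only: mult_le_cancel_left_pos[OF \<delta>])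
qed

text \<open>Larger levels sit higher on the line over \<open>x\<close>, and
  \<open>retract_height_mono\<close> gains at least the height difference, which is positive since
  the two points have different \<open>tau\<close>.\<close>

lemma iota_eps_strict_mono:
  assumes v: "future_timelike v" "mink v v = -1"
  shows "strict_mono_on {0<..} (\<lambda>\<epsilon>. iota_eps D v \<epsilon> x)"
proof (rule strict_mono_onI)
  fix \<epsilon> \<epsilon>' :: real assume "\<epsilon> \<in> {0<..}" "\<epsilon>' \<in> {0<..}" and lt: "\<epsilon> < \<epsilon>'"
  then have pos: "0 < \<epsilon>" "0 < \<epsilon>'" by auto
  define s s' where "s = graph_fun D v \<epsilon> x" and "s' = graph_fun D v \<epsilon>' x"
  have s: "x + s *\<^sub>R v \<in> D" "tau (x + s *\<^sub>R v) = \<epsilon>" and s': "x + s' *\<^sub>R v \<in> D" "tau (x + s' *\<^sub>R v) = \<epsilon>'"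
    using graph_fun_level[OF v pos(1)] graph_fun_level[OF v pos(2)] by (auto simp: s_def s'_def)
  have "s \<le> s'" unfolding s_def using v pos s' lt by (intro graph_fun_le) auto
  moreover have "s \<noteq> s'" using s s' lt by auto
  ultimately have "0 < s' - s" by simp
  have eq: "x + s *\<^sub>R v + (s' - s) *\<^sub>R v = x + s' *\<^sub>R v" by (simp add: algebra_simps)
  have "iota_eps D v \<epsilon> x + (s' - s) \<le> iota_eps D v \<epsilon>' x"
    using retract_height_mono[OF v s(1) \<open>0 < s' - s\<close>]
    unfolding eq iota_eps_tau[OF v s(1), symmetric] iota_eps_tau[OF v s'(1), symmetric] s(2) s'(2) .
  then show "iota_eps D v \<epsilon> x < iota_eps D v \<epsilon>' x" using \<open>0 < s' - s\<close> by linarith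
qed

section \<open>The limit as an infimum, and its local boundedness\<close>

lemma iota_eps_nonneg:
  assumes v: "future_timelike v" "mink v v = -1" and "0 < \<epsilon>"
  shows "0 \<le> iota_eps D v \<epsilon> x"
  unfolding iota_eps_tau[OF v graph_fun_level(1)[OF assms], of x, unfolded graph_fun_level(2)[OF assms]]
  using mink_causal_nonpos[OF retract_causal[OF graph_fun_level(1)[OF assms, of x]]
      causal_cone_timelike[OF v(1)]] by simp

lemma bdd_below_iota_eps:
  assumes "future_timelike v" "mink v v = -1"
  shows "bdd_below ((\<lambda>\<epsilon>. iota_eps D v \<epsilon> x) ` {0<..})"
  using iota_eps_nonneg[OF assms, of _ x] by (intro bdd_belowI[of _ 0]) auto

lemma iota_eps_tendsto_INF:
  assumes "future_timelike v" "mink v v = -1"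
  shows "((\<lambda>\<epsilon>. iota_eps D v \<epsilon> x) \<longlongrightarrow> (INF \<epsilon>\<in>{0<..}. iota_eps D v \<epsilon> x)) (at_right 0)"
  by (intro mono_on_tendsto_INF_at_right strict_mono_on_imp_mono_on iota_eps_strict_mono
      bdd_below_iota_eps assms)

lemma iota_eq_INF:
  assumes "future_timelike v" "mink v v = -1"
  shows "iota D v x = (INF \<epsilon>\<in>{0<..}. iota_eps D v \<epsilon> x)"
  unfolding iota_def by (rule tendsto_Lim[OF _ iota_eps_tendsto_INF[OF assms]]) simp

text \<open>As an infimum, \<open>iota\<close> lies below every \<open>iota_eps\<close>, and the
  level may vary with the base point. Over a small ball the points at fixed height \<open>s\<close>
  stay in \<open>D\<close>, where \<open>past_bounded\<close> controls their distance to the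
  retraction.\<close>

lemma iota_locally_bounded:
  assumes v: "future_timelike v" "mink v v = -1"
  shows "\<exists>r>0. bounded (iota D v ` ball x r)"
proof -
  \<comment> \<open>The level 1 is an arbitrary choice that supplies a point of \<open>D\<close> on
    the line over \<open>x\<close>.\<close>
  define s where "s = graph_fun D v 1 x"
  define p0 where "p0 = x + s *\<^sub>R v"
  have "p0 \<in> D" using graph_fun_level[OF v, of 1 x] by (simp add: p0_def s_def)
  then obtain r where r: "r > 0" "ball p0 r \<subseteq> D" using open_D open_contains_ball by blast
  obtain C u where u:
    "\<And>p q. q \<in> closure D \<Longrightarrow> causal_cone (p - q) \<Longrightarrow> norm (p - q) \<le> C - mink p u"
    using past_bounded by metis
  have "\<bar>iota D v x'\<bar> \<le> (C - mink p0 u + r * norm u) * norm v" if "x' \<in> ball x r" for x'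
  proof -
    define p where "p = x' + s *\<^sub>R v"
    have dist: "norm (p - p0) < r" using that by (simp add: p_def p0_def dist_norm norm_minus_commute)
    then have pD: "p \<in> D" using r(2) by (auto simp: dist_norm norm_minus_commute)
    have "0 \<le> iota D v x'" unfolding iota_eq_INF[OF v]
      using iota_eps_nonneg[OF v] by (intro cINF_greatest) auto
    moreover have "iota D v x' \<le> iota_eps D v (tau p) x'" unfolding iota_eq_INF[OF v]
      using tau_pos[OF pD] by (intro cINF_lower bdd_below_iota_eps v) auto
    moreover have "iota_eps D v (tau p) x' = - mink (p - retract p) v"
      using iota_eps_tau[OF v, of x' s] pD by (simp add: p_def)
    moreover have "- mink (p - retract p) v \<le> norm (p - retract p) * norm v"
      using abs_mink_le[of "p - retract p" v] by linarith
    moreover have "norm (p - retract p) \<le> C - mink p0 u + r * norm u"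
    proof -
      have "\<bar>mink (p - p0) u\<bar> \<le> norm (p - p0) * norm u" by (rule abs_mink_le)
      also have "\<dots> \<le> r * norm u" using dist by (intro mult_right_mono) auto
      finally show ?thesis
        using u[OF retract_closure[OF pD] retract_causal[OF pD]] by (simp add: mink_bilinear)
    qed
    then have "norm (p - retract p) * norm v \<le> (C - mink p0 u + r * norm u) * norm v"
      by (intro mult_right_mono) auto
    ultimately show ?thesis by linarith
  qed
  then have "bounded (iota D v ` ball x r)" unfolding bounded_iff real_norm_def by blast
  then show ?thesis using r(1) by blast
qed

end

theorem proposition3p1:
  fixes D :: "'n::finite minkowski set" and v :: "'n minkowski"
  assumes "domain_of_dependence D"
    and "future_timelike v" and "mink v v = -1"
  shows "(\<forall>x\<in>orth_hyperplane v. strict_mono_on {0<..} (\<lambda>\<epsilon>. iota_eps D v \<epsilon> x)) \<and>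
    (\<forall>x\<in>orth_hyperplane v.
       ((\<lambda>\<epsilon>. iota_eps D v \<epsilon> x) \<longlongrightarrow> iota D v x) (at_right 0) \<and>
       bdd_below ((\<lambda>\<epsilon>. iota_eps D v \<epsilon> x) ` {0<..}) \<and>
       iota D v x = (INF \<epsilon>\<in>{0<..}. iota_eps D v \<epsilon> x)) \<and>
    (\<forall>x\<in>orth_hyperplane v. \<exists>r>0. bounded (iota D v ` (orth_hyperplane v \<inter> ball x r)))"
proof -
  interpret dependence_domain D by unfold_locales fact
  note v = assms(2,3)
  have "\<exists>r>0. bounded (iota D v ` (orth_hyperplane v \<inter> ball x r))" for x
    using iota_locally_bounded[OF v, of x] by (meson bounded_subset image_mono inf_le2)
  then show ?thesis
    using iota_eps_strict_mono[OF v] iota_eps_tendsto_INF[OF v] bdd_below_iota_eps[OF v]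
      iota_eq_INF[OF v] by simp
qed

end
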